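(* Suppose that $P_{Lw}(\mathbb{N})>\frac12$ for every finite word $w\in\{L,R\}^\star$. Then $\mu_v(\mathbb{N})>\frac12$ for every finite word $v\in\{L,R\}^\star$.
   Context: $\mathbb{N}=\{0,1,2,\dots\}$. For $n\in\mathbb{N}$, $s(n)$ is the number of ones in the binary expansion of $n$. For $t\in\mathbb{N}$, $d\in\mathbb{Z}$, $\mu_t(d)=\lim_{N\to\infty}\frac1N|\{n<N: s(n+t)-s(n)=d\}|$; it is well known that the limit exists and $\mu_t$ is a probability measure on $\mathbb{Z}$ with mean zero. $\{L,R\}^\star$ is the set of finite words in $L,R$, including the empty word $\varepsilon$; $Lw$ is the word $w$ preceded by the letter $L$. On odd positive integers let $L(t)=2t-1$, $R(t)=2t+1$. A word $v=v_1\dots v_n$ is identified with the odd integer $v_n\circ\cdots\circ v_1(3)$ ($\varepsilon$ with $3$), and $\mu_v$ means $\mu_t$ for the corresponding $t$. For probability measures $\mu,\nu$ on $\mathbb{Z}$ with mean zero, $\Phi(\mu,\nu)(d)=\frac12\mu(d+1)+\frac12\nu(d-1)$, $\Phi_L(\mu,\nu)=(\Phi(\mu,\nu),\nu)$, $\Phi_R(\mu,\nu)=(\mu,\Phi(\mu,\nu))$. For a word $w=w_1\dots w_n$ put $P_w=\Phi\circ\Phi_{w_n}\circ\cdots\circ\Phi_{w_1}(\delta_0,\delta_0)$, with $P_\varepsilon=\frac12\delta_{-1}+\frac12\delta_1$. *)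

theory Defs
  imports "HOL-Probability.Probability" "HOL-Real_Asymp.Real_Asymp"
begin

definition binary_ones :: "nat \<Rightarrow> nat" where
  "binary_ones n = card {i. bit n i}"

definition digit_freq :: "nat \<Rightarrow> int \<Rightarrow> nat \<Rightarrow> real" where
  "digit_freq t d N =
     real (card {n. n < N \<and> int (binary_ones (n + t)) - int (binary_ones n) = d}) / real N"

text \<open>Neither \<open>lim\<close> nor \<open>embed_pmf\<close> below is an arbitrary value: see \<open>mu_limit\<close>.\<close>

definition mu :: "nat \<Rightarrow> int pmf" where
  "mu t = embed_pmf (\<lambda>d. lim (digit_freq t d))"

datatype letter = L | R

text \<open>Only applied to odd, hence positive, numbers, so the subtraction does not truncate.\<close>

fun letter_map :: "letter \<Rightarrow> nat \<Rightarrow> nat" where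
  "letter_map L t = 2 * t - 1"
| "letter_map R t = 2 * t + 1"

definition word_int :: "letter list \<Rightarrow> nat" where
  "word_int v = fold letter_map v 3"

text \<open>The right-hand side is a probability mass function for all arguments (\<open>pmf_Phi\<close>), and
  has mean zero if both arguments do, so the domain is not restricted to mean zero.\<close>

definition Phi :: "int pmf \<Rightarrow> int pmf \<Rightarrow> int pmf" where
  "Phi \<mu> \<nu> = embed_pmf (\<lambda>d. 1/2 * pmf \<mu> (d + 1) + 1/2 * pmf \<nu> (d - 1))"

fun Phi_letter :: "letter \<Rightarrow> int pmf \<times> int pmf \<Rightarrow> int pmf \<times> int pmf" where
  "Phi_letter L (\<mu>, \<nu>) = (Phi \<mu> \<nu>, \<nu>)"
| "Phi_letter R (\<mu>, \<nu>) = (\<mu>, Phi \<mu> \<nu>)"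

definition P_word :: "letter list \<Rightarrow> int pmf" where
  "P_word w = case_prod Phi (fold Phi_letter w (return_pmf 0, return_pmf 0))"


subsection \<open>Well-definedness\<close>

lemma embed_pmf_pmf: "embed_pmf (pmf p) = p"
  by (rule pmf_eqI, subst pmf_embed_pmf) (auto simp: nn_integral_pmf measure_pmf.emeasure_space_1)

lemma pmf_Phi: "pmf (Phi \<mu> \<nu>) d = 1/2 * pmf \<mu> (d + 1) + 1/2 * pmf \<nu> (d - 1)"
proof -
  define p where "p = bernoulli_pmf (1/2) \<bind>
    (\<lambda>b. if b then map_pmf (\<lambda>d. d - 1) \<mu> else map_pmf (\<lambda>d. d + 1) \<nu>)"
  have "pmf (map_pmf (\<lambda>d::int. d - 1) \<mu>) d = pmf \<mu> (d + 1)" for d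
    using pmf_map_inj'[of "\<lambda>d::int. d - 1" \<mu> "d + 1"] by (simp add: inj_def)
  moreover have "pmf (map_pmf (\<lambda>d::int. d + 1) \<nu>) d = pmf \<nu> (d - 1)" for d
    using pmf_map_inj'[of "\<lambda>d::int. d + 1" \<nu> "d - 1"] by (simp add: inj_def)
  ultimately have "pmf p = (\<lambda>d. 1/2 * pmf \<mu> (d + 1) + 1/2 * pmf \<nu> (d - 1))"
    unfolding p_def by (auto simp: pmf_bind fun_eq_iff)
  then show ?thesis
    unfolding Phi_def by (metis embed_pmf_pmf)
qed

lemma P_word_Nil: "pmf (P_word []) d = 1/2 * indicator {-1} d + 1/2 * indicator {1} d"
  by (auto simp: P_word_def pmf_Phi indicator_def)

lemma binary_ones_0 [simp]: "binary_ones 0 = 0"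
  by (simp add: binary_ones_def)

lemma finite_bits: "finite {i. bit (n::nat) i}"
proof (rule finite_subset)
  show "{i. bit n i} \<subseteq> {..<n}"
  proof
    fix i assume "i \<in> {i. bit n i}"
    then have "n div 2 ^ i \<noteq> 0" by (auto simp: bit_iff_odd intro: ccontr)
    then have "2 ^ i \<le> n" by (metis div_less linorder_not_less)
    moreover have "i < 2 ^ i" by (rule less_exp)
    ultimately show "i \<in> {..<n}" by (metis lessThan_iff order_less_le_trans)
  qed
qed simp

lemma binary_ones_double [simp]: "binary_ones (2 * n) = binary_ones n"
proof -
  have "{i. bit (2 * n) i} = Suc ` {i. bit n i}"
    by (auto simp: image_iff bit_double_iff gr0_conv_Suc)
  then show ?thesis by (simp add: binary_ones_def card_image)
qed

lemma binary_ones_double_Suc [simp]: "binary_ones (Suc (2 * n)) = Suc (binary_ones n)"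
proof -
  have "bit (Suc (2 * n)) i \<longleftrightarrow> i = 0 \<or> i \<in> Suc ` {i. bit n i}" for i
    by (cases i) (auto simp: bit_Suc bit_0)
  then have "{i. bit (Suc (2 * n)) i} = insert 0 (Suc ` {i. bit n i})" by auto
  then show ?thesis by (simp add: binary_ones_def card_image finite_bits)
qed

lemma digit_freq_merge:
  assumes "\<And>m. int (binary_ones (2 * m + t)) - int (binary_ones (2 * m)) = d
              \<longleftrightarrow> int (binary_ones (m + a)) - int (binary_ones m) = d1"
    and "\<And>m. int (binary_ones (Suc (2 * m) + t)) - int (binary_ones (Suc (2 * m))) = d
              \<longleftrightarrow> int (binary_ones (m + b)) - int (binary_ones m) = d2"
    and "digit_freq a d1 \<longlonglongrightarrow> x" and "digit_freq b d2 \<longlonglongrightarrow> y"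
  shows "digit_freq t d \<longlonglongrightarrow> (x + y) / 2"
proof -
  let ?A = "\<lambda>t d N. {n. n < N \<and> int (binary_ones (n + t)) - int (binary_ones n) = d}"
  have *: "?A t d N = (\<lambda>m. 2 * m) ` ?A a d1 ((N + 1) div 2) \<union> (\<lambda>m. Suc (2 * m)) ` ?A b d2 (N div 2)"
    for N
  proof (rule set_eqI)
    fix n
    show "n \<in> ?A t d N \<longleftrightarrow>
      n \<in> (\<lambda>m. 2 * m) ` ?A a d1 ((N + 1) div 2) \<union> (\<lambda>m. Suc (2 * m)) ` ?A b d2 (N div 2)"
    proof (cases "even n")
      case True
      then obtain m where m: "n = 2 * m" by blast
      have "2 * m < N \<longleftrightarrow> m < (N + 1) div 2" by linarith
      moreover have "2 * m \<noteq> Suc (2 * k)" for k by presburger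
      ultimately show ?thesis using assms(1)[of m] unfolding m by (auto simp del: binary_ones_double)
    next
      case False
      then obtain m where m: "n = Suc (2 * m)" by (auto elim: oddE)
      have "Suc (2 * m) < N \<longleftrightarrow> m < N div 2" by linarith
      moreover have "Suc (2 * m) \<noteq> 2 * k" for k by presburger
      ultimately show ?thesis using assms(2)[of m] unfolding m
        by (auto simp del: binary_ones_double_Suc)
    qed
  qed
  have "card (?A t d N) = card (?A a d1 ((N + 1) div 2)) + card (?A b d2 (N div 2))" for N
    unfolding * by (subst card_Un_disjoint) (auto simp: card_image inj_on_def, presburger)
  then have split: "digit_freq t d N =
      real (card (?A a d1 ((N + 1) div 2))) / real N + real (card (?A b d2 (N div 2))) / real N" for N
    unfolding digit_freq_def by (simp add: add_divide_distrib)
  have scale: "real (card (?A u e M)) / real N = digit_freq u e M * (real M / real N)" for u e M N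
    by (cases "M = 0") (simp_all add: digit_freq_def)
  have eq: "digit_freq t d N =
      digit_freq a d1 ((N + 1) div 2) * (real ((N + 1) div 2) / real N)
      + digit_freq b d2 (N div 2) * (real (N div 2) / real N)" for N
    unfolding split scale ..
  have half1: "filterlim (\<lambda>N::nat. N div 2) at_top at_top"
    unfolding filterlim_at_top eventually_at_top_linorder
  proof
    fix Z :: nat
    have "\<forall>n\<ge>2 * Z. Z \<le> n div 2" by auto
    then show "\<exists>N. \<forall>n\<ge>N. Z \<le> n div 2" ..
  qed
  have half2: "filterlim (\<lambda>N::nat. (N + 1) div 2) at_top at_top"
    by (rule filterlim_at_top_mono[OF half1]) (auto intro!: always_eventually div_le_mono)
  have r1: "(\<lambda>N. real ((N + 1) div 2) / real N) \<longlonglongrightarrow> 1/2"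
  proof (rule tendsto_sandwich)
    show "\<forall>\<^sub>F N in sequentially. (real N / 2) / real N \<le> real ((N + 1) div 2) / real N"
      by (intro always_eventually allI divide_right_mono) linarith+
    show "\<forall>\<^sub>F N in sequentially. real ((N + 1) div 2) / real N \<le> (real N / 2 + 1 / 2) / real N"
      by (intro always_eventually allI divide_right_mono) linarith+
  qed real_asymp+
  have r2: "(\<lambda>N. real (N div 2) / real N) \<longlonglongrightarrow> 1/2"
  proof (rule tendsto_sandwich)
    show "\<forall>\<^sub>F N in sequentially. (real N / 2 - 1 / 2) / real N \<le> real (N div 2) / real N"
      by (intro always_eventually allI divide_right_mono) linarith+
    show "\<forall>\<^sub>F N in sequentially. real (N div 2) / real N \<le> (real N / 2) / real N"
      by (intro always_eventually allI divide_right_mono) linarith+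
  qed real_asymp+
  have "(\<lambda>N. digit_freq a d1 ((N + 1) div 2) * (real ((N + 1) div 2) / real N)
      + digit_freq b d2 (N div 2) * (real (N div 2) / real N)) \<longlonglongrightarrow> x * (1/2) + y * (1/2)"
    by (intro tendsto_add tendsto_mult r1 r2 filterlim_compose[OF assms(3) half2]
        filterlim_compose[OF assms(4) half1])
  then show ?thesis unfolding eq[symmetric] by (simp add: field_simps)
qed

lemma digit_freq_0: "digit_freq 0 d \<longlonglongrightarrow> pmf (return_pmf 0) d"
proof -
  have "digit_freq 0 d N = pmf (return_pmf 0) d" if "N > 0" for N
    using that by (auto simp: digit_freq_def indicator_def)
  then show ?thesis
    by (intro tendsto_eventually eventually_at_top_linorderI[of 1]) auto
qed

lemma digit_freq_1:
  "digit_freq 1 d \<longlonglongrightarrow> pmf (map_pmf (\<lambda>k. 1 - int k) (geometric_pmf (1/2))) d"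
proof -
  have inj: "inj (\<lambda>k. 1 - int k)" by (auto simp: inj_def)
  have le: "int (binary_ones (n + 1)) - int (binary_ones n) \<le> 1" for n
  proof (induction n rule: less_induct)
    case (less n)
    show ?case
    proof (cases "even n")
      case True
      then obtain m where "n = 2 * m" by blast
      then show ?thesis by simp
    next
      case False
      then obtain m where m: "n = Suc (2 * m)" by (auto elim: oddE)
      have "binary_ones (n + 1) = binary_ones (m + 1)"
        using binary_ones_double[of "m + 1"] by (simp add: m)
      then show ?thesis using less[of m] by (simp add: m)
    qed
  qed
  have odd: "int (binary_ones (Suc (2 * m) + 1)) - int (binary_ones (Suc (2 * m))) = d
      \<longleftrightarrow> int (binary_ones (m + 1)) - int (binary_ones m) = d + 1" for m d
    using binary_ones_double[of "m + 1"] by auto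
  have big: "digit_freq 1 d \<longlonglongrightarrow> 0" if "d > 1" for d
  proof -
    have "int (binary_ones (n + 1)) - int (binary_ones n) \<noteq> d" for n using le[of n] that by linarith
    then have "digit_freq 1 d = (\<lambda>N. 0)" unfolding digit_freq_def by simp
    then show ?thesis by simp
  qed
  have "digit_freq 1 (1 - int k) \<longlonglongrightarrow> (1/2) ^ Suc k" for k
  proof (induction k)
    case 0
    have "digit_freq 1 1 \<longlonglongrightarrow> (1 + 0) / 2"
      by (rule digit_freq_merge[of 1 1 0 0 1 2])
        (use odd[of _ 1] digit_freq_0[of 0] big[of 2] in auto)
    then show ?case by simp
  next
    case (Suc k)
    have "digit_freq 1 (- int k) \<longlonglongrightarrow> (0 + (1/2) ^ Suc k) / 2"
      by (rule digit_freq_merge[of 1 "- int k" 0 1 1 "1 - int k"])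
        (use odd[of _ "- int k"] digit_freq_0[of 1] Suc in \<open>auto simp: add.commute\<close>)
    then show ?case by simp
  qed
  moreover have "pmf (map_pmf (\<lambda>k. 1 - int k) (geometric_pmf (1/2))) (1 - int k) = (1/2) ^ Suc k" for k
    using pmf_map_inj'[OF inj] by simp
  moreover have "pmf (map_pmf (\<lambda>k. 1 - int k) (geometric_pmf (1/2))) d = 0" if "d > 1"
    using that by (intro pmf_map_outside) auto
  moreover have "d > 1 \<or> (\<exists>k. d = 1 - int k)"
    by (metis add_diff_cancel_left' add_diff_eq diff_add_cancel linorder_not_le zle_iff_zadd)
  ultimately show ?thesis using big by (metis (no_types, lifting))
qed

lemma digit_freq_pmf: "\<exists>p. \<forall>d. digit_freq t d \<longlonglongrightarrow> pmf p d"
proof (induction t rule: less_induct)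
  case (less t)
  consider "t = 0" | "t = 1" | m where "t = 2 * m" "m > 0" | m where "t = 2 * m + 1" "m > 0"
    by (metis One_nat_def Suc_eq_plus1 bot_nat_0.not_eq_extremum mult_0_right oddE dvdE add_0)
  then show ?case
  proof cases
    case 1
    then show ?thesis using digit_freq_0 by blast
  next
    case 2
    then show ?thesis using digit_freq_1 by blast
  next
    case 3
    then obtain p where p: "\<forall>d. digit_freq m d \<longlonglongrightarrow> pmf p d" using less[of m] by auto
    have "digit_freq t d \<longlonglongrightarrow> (pmf p d + pmf p d) / 2" for d
    proof (rule digit_freq_merge[OF _ _ p[rule_format] p[rule_format]])
      fix i
      show "int (binary_ones (2 * i + t)) - int (binary_ones (2 * i)) = d
          \<longleftrightarrow> int (binary_ones (i + m)) - int (binary_ones i) = d"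
        using binary_ones_double[of "i + m"] 3 by simp
      show "int (binary_ones (Suc (2 * i) + t)) - int (binary_ones (Suc (2 * i))) = d
          \<longleftrightarrow> int (binary_ones (i + m)) - int (binary_ones i) = d"
        using binary_ones_double_Suc[of "i + m"] 3 by simp
    qed
    then show ?thesis by auto
  next
    case 4
    then obtain p q where p: "\<forall>d. digit_freq m d \<longlonglongrightarrow> pmf p d"
      and q: "\<forall>d. digit_freq (m + 1) d \<longlonglongrightarrow> pmf q d"
      using less[of m] less[of "m + 1"] by auto
    have "digit_freq t d \<longlonglongrightarrow> (pmf p (d - 1) + pmf q (d + 1)) / 2" for d
    proof (rule digit_freq_merge[OF _ _ p[rule_format] q[rule_format]])
      fix i
      show "int (binary_ones (2 * i + t)) - int (binary_ones (2 * i)) = d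
          \<longleftrightarrow> int (binary_ones (i + m)) - int (binary_ones i) = d - 1"
        using binary_ones_double_Suc[of "i + m"] 4 by auto
      show "int (binary_ones (Suc (2 * i) + t)) - int (binary_ones (Suc (2 * i))) = d
          \<longleftrightarrow> int (binary_ones (i + (m + 1))) - int (binary_ones i) = d + 1"
        using binary_ones_double[of "i + m + 1"] 4 by auto
    qed
    then have "\<forall>d. digit_freq t d \<longlonglongrightarrow> pmf (Phi q p) d"
      by (simp add: pmf_Phi field_simps)
    then show ?thesis by blast
  qed
qed

lemma mu_limit: "digit_freq t d \<longlonglongrightarrow> pmf (mu t) d"
proof -
  obtain p where p: "\<forall>d. digit_freq t d \<longlonglongrightarrow> pmf p d" using digit_freq_pmf by blast
  then have "(\<lambda>d. lim (digit_freq t d)) = pmf p" by (auto intro: limI)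
  then show ?thesis using p by (simp add: mu_def embed_pmf_pmf)
qed

end

theory Submission
  imports Defs
begin

text \<open>Since \<open>L(1) = 1\<close> and \<open>R(1) = 3\<close>, the integer of \<open>v\<close> is reached from \<open>1\<close> by reading
  \<open>L\<^sup>k R v\<close> for every \<open>k\<close>, so \<open>\<mu>\<^sub>v\<close> arises from \<open>(\<mu>\<^sub>1, \<delta>\<^sub>0)\<close> by the same maps that produce
  \<open>P\<close> of the word \<open>L\<^sup>k R v\<close> from \<open>(\<delta>\<^sub>0, \<delta>\<^sub>0)\<close>. The two starting pairs agree at all \<open>d \<ge> 2\<close>. Each
  initial \<open>L\<close> lowers this threshold by one, as the second components are equal, and each later
  application of \<open>\<Phi>\<close> raises it by at most one. So for large \<open>k\<close> the two measures coincide
  on \<open>\<nat>\<close>, and no strictness is lost in a limit.\<close>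

lemma mu_eqI:
  assumes "\<And>d. digit_freq t d \<longlonglongrightarrow> pmf p d"
  shows "mu t = p"
  by (rule pmf_eqI) (rule LIMSEQ_unique[OF mu_limit assms])

lemma mu_0: "mu 0 = return_pmf 0"
  by (rule mu_eqI) (rule digit_freq_0)

lemma mu_1: "mu 1 = map_pmf (\<lambda>k. 1 - int k) (geometric_pmf (1/2))"
  by (rule mu_eqI) (rule digit_freq_1)

lemma mu_double: "mu (2 * m) = mu m"
proof (rule mu_eqI)
  fix d
  have "digit_freq (2 * m) d \<longlonglongrightarrow> (pmf (mu m) d + pmf (mu m) d) / 2"
  proof (rule digit_freq_merge[OF _ _ mu_limit mu_limit])
    fix i
    show "int (binary_ones (2 * i + 2 * m)) - int (binary_ones (2 * i)) = d
        \<longleftrightarrow> int (binary_ones (i + m)) - int (binary_ones i) = d"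
      using binary_ones_double[of "i + m"] by simp
    show "int (binary_ones (Suc (2 * i) + 2 * m)) - int (binary_ones (Suc (2 * i))) = d
        \<longleftrightarrow> int (binary_ones (i + m)) - int (binary_ones i) = d"
      using binary_ones_double_Suc[of "i + m"] by simp
  qed
  then show "digit_freq (2 * m) d \<longlonglongrightarrow> pmf (mu m) d" by simp
qed

text \<open>Parity of n: for even n there is no carry and a digit one is gained; for odd n the last
  one is lost and the carry turns m into m + 1.\<close>

lemma mu_Suc_double: "mu (Suc (2 * m)) = Phi (mu (Suc m)) (mu m)"
proof (rule mu_eqI)
  fix d
  have "digit_freq (Suc (2 * m)) d \<longlonglongrightarrow> (pmf (mu m) (d - 1) + pmf (mu (Suc m)) (d + 1)) / 2"
  proof (rule digit_freq_merge[OF _ _ mu_limit mu_limit])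
    fix i
    show "int (binary_ones (2 * i + Suc (2 * m))) - int (binary_ones (2 * i)) = d
        \<longleftrightarrow> int (binary_ones (i + m)) - int (binary_ones i) = d - 1"
      using binary_ones_double_Suc[of "i + m"] by auto
    show "int (binary_ones (Suc (2 * i) + Suc (2 * m))) - int (binary_ones (Suc (2 * i))) = d
        \<longleftrightarrow> int (binary_ones (i + Suc m)) - int (binary_ones i) = d + 1"
      using binary_ones_double[of "i + Suc m"] by auto
  qed
  then show "digit_freq (Suc (2 * m)) d \<longlonglongrightarrow> pmf (Phi (mu (Suc m)) (mu m)) d"
    by (simp add: pmf_Phi field_simps)
qed

text \<open>The letter L replaces m by 2m and R by 2m + 1; in the new pair one index is even and is
  halved by \<open>mu_double\<close>, the other is odd and yields \<open>Phi\<close>.\<close>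

lemma mu_fold_letter_map:
  "mu (fold letter_map w (Suc (2 * m))) = case_prod Phi (fold Phi_letter w (mu (Suc m), mu m))"
proof (induction w arbitrary: m)
  case Nil
  then show ?case by (simp add: mu_Suc_double)
next
  case (Cons a w)
  show ?case
  proof (cases a)
    case L
    then show ?thesis using Cons[of "2 * m"] by (simp add: mu_double mu_Suc_double)
  next
    case R
    then show ?thesis
      using Cons[of "Suc (2 * m)"] mu_double[of "Suc m"] by (simp add: mu_Suc_double)
  qed
qed

lemma word_int_eq_fold: "word_int v = fold letter_map (replicate k L @ R # v) 1"
proof -
  have "fold letter_map (replicate k L) 1 = 1" by (induction k) auto
  then show ?thesis by (simp add: word_int_def numeral_3_eq_3)
qed

lemma pmf_Phi_agree:
  assumes "\<And>d. d \<ge> c \<Longrightarrow> pmf p d = pmf p' d" "\<And>d. d \<ge> c \<Longrightarrow> pmf q d = pmf q' d"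
    and "d \<ge> c + 1"
  shows "pmf (Phi p q) d = pmf (Phi p' q') d"
  using assms by (simp add: pmf_Phi)

lemma pmf_Phi_fold_agree:
  assumes "\<And>d. d \<ge> c \<Longrightarrow> pmf p d = pmf p' d" "\<And>d. d \<ge> c \<Longrightarrow> pmf q d = pmf q' d"
    and "d \<ge> c + int (length w) + 1"
  shows "pmf (case_prod Phi (fold Phi_letter w (p, q))) d
       = pmf (case_prod Phi (fold Phi_letter w (p', q'))) d"
  using assms
proof (induction w arbitrary: p q p' q' c)
  case Nil
  then show ?case using pmf_Phi_agree[of c p p' q q' d] by simp
next
  case (Cons a w)
  note Phi = pmf_Phi_agree[of c p p' q q', OF Cons.prems(1,2)]
  show ?case
  proof (cases a)
    case L
    then show ?thesis
      using Cons.IH[of "c + 1" "Phi p q" "Phi p' q'" q q'] Phi Cons.prems by simp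
  next
    case R
    then show ?thesis
      using Cons.IH[of "c + 1" p p' "Phi p q" "Phi p' q'"] Phi Cons.prems by simp
  qed
qed

lemma funpow_Phi_letter_L:
  "(Phi_letter L ^^ k) (p, q) = (((\<lambda>r. Phi r q) ^^ k) p, q)"
  by (induction k) auto

text \<open>\<open>Phi r q\<close> at d involves \<open>r\<close> only at d + 1, and the terms in
  \<open>q\<close> are equal.\<close>

lemma pmf_funpow_Phi_agree:
  assumes "\<And>d. d \<ge> c \<Longrightarrow> pmf p d = pmf p' d" and "d \<ge> c - int k"
  shows "pmf (((\<lambda>r. Phi r q) ^^ k) p) d = pmf (((\<lambda>r. Phi r q) ^^ k) p') d"
  using assms(2) by (induction k arbitrary: d) (auto simp: pmf_Phi assms(1))

text \<open>Adding 1 to n gains at most one digit one; hence the starting threshold 2.\<close>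

lemma pmf_mu_1_eq_0:
  assumes "d \<ge> 2"
  shows "pmf (mu 1) d = 0"
  unfolding mu_1 using assms by (intro pmf_map_outside) auto

lemma pmf_mu_word_int:
  assumes "k \<ge> length v + 4" and "d \<ge> 0"
  shows "pmf (mu (word_int v)) d = pmf (P_word (replicate k L @ R # v)) d"
proof -
  let ?f = "(\<lambda>r. Phi r (return_pmf 0)) ^^ k"
  have "mu (word_int v) = case_prod Phi (fold Phi_letter (R # v) (?f (mu 1), return_pmf 0))"
    using mu_fold_letter_map[of "replicate k L @ R # v" 0]
    unfolding word_int_eq_fold[of v k]
    by (simp add: mu_0 funpow_Phi_letter_L del: fold.simps)
  moreover have "P_word (replicate k L @ R # v)
      = case_prod Phi (fold Phi_letter (R # v) (?f (return_pmf 0), return_pmf 0))"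
    unfolding P_word_def by (simp add: funpow_Phi_letter_L del: fold.simps)
  moreover have "pmf (?f (mu 1)) e = pmf (?f (return_pmf 0)) e" if "e \<ge> 2 - int k" for e
    using that by (intro pmf_funpow_Phi_agree[of 2]) (simp_all add: pmf_mu_1_eq_0[simplified])
  \<comment> \<open>The threshold 2 - k grows by the length of \<open>R # v\<close> and by 1 for the
    final \<open>Phi\<close>, giving length v + 4 - k, which is at most 0.\<close>
  ultimately show ?thesis
    using assms pmf_Phi_fold_agree[of "2 - int k" "?f (mu 1)" "?f (return_pmf 0)"
        "return_pmf 0" "return_pmf 0" "R # v" d]
    by (simp del: fold.simps)
qed

theorem lemma25:
  assumes "\<forall>w. measure_pmf.prob (P_word (L # w)) {0..} > 1/2"
  shows "\<forall>v. measure_pmf.prob (mu (word_int v)) {0..} > 1/2"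
proof
  fix v :: "letter list"
  let ?k = "length v + 4"
  have "measure_pmf.prob (mu (word_int v)) {0..}
      = measure_pmf.prob (P_word (replicate ?k L @ R # v)) {0..}"
    unfolding measure_pmf_conv_infsetsum
    by (intro infsetsum_cong) (auto intro: pmf_mu_word_int)
  \<comment> \<open>As \<open>?k\<close> is positive, the word starts with L, as the hypothesis
    demands.\<close>
  also have "replicate ?k L @ R # v = L # (replicate (length v + 3) L @ R # v)"
    by (simp add: eval_nat_numeral)
  finally show "measure_pmf.prob (mu (word_int v)) {0..} > 1/2"
    using assms by simp
qed

end
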